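(* Let $k$ be an arbitrary field and let $H$ be a Hopf algebra over $k$ with antipode $S$. If $S(H)$ contains the coradical $H_0$ of $H$, then $S$ is surjective.
   Context: The coradical $H_0$ of $H$ is the sum of all simple subcoalgebras of $H$. *)

theory Defs
  imports Complex_Main "HOL-Library.Poly_Mapping"
begin

text \<open>
  A vector space over a field is given by a type of class \<^class>\<open>ab_group_add\<close> with a scalar
  multiplication satisfying \<^locale>\<open>vector_space\<close>.  The free vector space on a set of
  symbols is the type of finitely supported functions, with the following scaling.
\<close>

definition free_scale :: "'k::field \<Rightarrow> ('x \<Rightarrow>\<^sub>0 'k) \<Rightarrow> ('x \<Rightarrow>\<^sub>0 'k)" where
  "free_scale c u = Poly_Mapping.map ((*) c) u"

text \<open>The linear map out of the free vector space that is \<open>f\<close> on basis symbols.\<close>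

definition free_extend ::
  "('k::field \<Rightarrow> 'v::ab_group_add \<Rightarrow> 'v) \<Rightarrow> ('x \<Rightarrow> 'v) \<Rightarrow> ('x \<Rightarrow>\<^sub>0 'k) \<Rightarrow> 'v" where
  "free_extend scale f u =
     (\<Sum>p\<in>Poly_Mapping.keys u. scale (Poly_Mapping.lookup u p) (f p))"

lemma lookup_free_scale [simp]:
  "Poly_Mapping.lookup (free_scale c u) x = c * Poly_Mapping.lookup u x"
  by (simp add: free_scale_def Poly_Mapping.map.rep_eq when_def)

lemma vector_space_free_scale: "vector_space free_scale"
  by unfold_locales (auto intro!: poly_mapping_eqI simp: lookup_add algebra_simps)

text \<open>
  \<open>H \<otimes> H\<close> is the free vector space on \<open>H \<times> H\<close> modulo the subspace spanned by the bilinearity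
  relations; its elements are the equivalence classes.  A formal sum \<open>u\<close> in such a class
  is an expression of the tensor as \<open>\<Sum> u(a,b) a \<otimes> b\<close>.  In the same way \<open>H \<otimes> H \<otimes> H\<close> is obtained
  from the trilinearity relations.
\<close>

definition bilinear_relations ::
  "('k::field \<Rightarrow> 'h::ab_group_add \<Rightarrow> 'h) \<Rightarrow> ('h \<times> 'h \<Rightarrow>\<^sub>0 'k) set" where
  "bilinear_relations scale =
     {Poly_Mapping.single (a + a', b) 1 - Poly_Mapping.single (a, b) 1
        - Poly_Mapping.single (a', b) 1 | a a' b. True} \<union>
     {Poly_Mapping.single (a, b + b') 1 - Poly_Mapping.single (a, b) 1
        - Poly_Mapping.single (a, b') 1 | a b b'. True} \<union>
     {Poly_Mapping.single (scale c a, b) 1 - Poly_Mapping.single (a, b) c | c a b. True} \<union>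
     {Poly_Mapping.single (a, scale c b) 1 - Poly_Mapping.single (a, b) c | c a b. True}"

definition tensor_rel ::
  "('k::field \<Rightarrow> 'h::ab_group_add \<Rightarrow> 'h) \<Rightarrow> ('h \<times> 'h \<Rightarrow>\<^sub>0 'k) rel" where
  "tensor_rel scale = {(u, v). u - v \<in> module.span free_scale (bilinear_relations scale)}"

definition tensor_square ::
  "('k::field \<Rightarrow> 'h::ab_group_add \<Rightarrow> 'h) \<Rightarrow> ('h \<times> 'h \<Rightarrow>\<^sub>0 'k) set set" where
  "tensor_square scale = UNIV // tensor_rel scale"

definition trilinear_relations ::
  "('k::field \<Rightarrow> 'h::ab_group_add \<Rightarrow> 'h) \<Rightarrow> ('h \<times> 'h \<times> 'h \<Rightarrow>\<^sub>0 'k) set" where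
  "trilinear_relations scale =
     {Poly_Mapping.single (a + a', b, c) 1 - Poly_Mapping.single (a, b, c) 1
        - Poly_Mapping.single (a', b, c) 1 | a a' b c. True} \<union>
     {Poly_Mapping.single (a, b + b', c) 1 - Poly_Mapping.single (a, b, c) 1
        - Poly_Mapping.single (a, b', c) 1 | a b b' c. True} \<union>
     {Poly_Mapping.single (a, b, c + c') 1 - Poly_Mapping.single (a, b, c) 1
        - Poly_Mapping.single (a, b, c') 1 | a b c c'. True} \<union>
     {Poly_Mapping.single (scale r a, b, c) 1 - Poly_Mapping.single (a, b, c) r | r a b c. True} \<union>
     {Poly_Mapping.single (a, scale r b, c) 1 - Poly_Mapping.single (a, b, c) r | r a b c. True} \<union>
     {Poly_Mapping.single (a, b, scale r c) 1 - Poly_Mapping.single (a, b, c) r | r a b c. True}"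

definition tensor3_rel ::
  "('k::field \<Rightarrow> 'h::ab_group_add \<Rightarrow> 'h) \<Rightarrow> ('h \<times> 'h \<times> 'h \<Rightarrow>\<^sub>0 'k) rel" where
  "tensor3_rel scale = {(u, v). u - v \<in> module.span free_scale (trilinear_relations scale)}"

lemma equiv_tensor_rel: "equiv UNIV (tensor_rel scale)"
proof -
  interpret free: vector_space free_scale
    by (rule vector_space_free_scale)
  show ?thesis
  proof (rule equivI)
    show "refl (tensor_rel scale)"
      by (simp add: refl_on_def tensor_rel_def free.span_zero)
    show "sym (tensor_rel scale)"
      by (rule symI) (use free.span_neg in \<open>fastforce simp: tensor_rel_def\<close>)
    show "trans (tensor_rel scale)"
      by (rule transI) (use free.span_add in \<open>fastforce simp: tensor_rel_def\<close>)
  qed simp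
qed

text \<open>
  On formal sums, \<open>\<Delta> \<otimes> id\<close> and \<open>id \<otimes> \<Delta>\<close>, where \<open>d a\<close> is a chosen formal sum representing
  the coproduct of \<open>a\<close>, and the product \<open>(a \<otimes> b) (a' \<otimes> b') = a a' \<otimes> b b'\<close>.  All three respect the
  relations above, so the axioms below may be stated for arbitrary representatives.
\<close>

definition comult_left ::
  "('h \<Rightarrow> ('h \<times> 'h \<Rightarrow>\<^sub>0 'k)) \<Rightarrow> ('h \<times> 'h \<Rightarrow>\<^sub>0 'k::field) \<Rightarrow> ('h \<times> 'h \<times> 'h \<Rightarrow>\<^sub>0 'k)" where
  "comult_left d u = free_extend free_scale
     (\<lambda>(a, b). free_extend free_scale (\<lambda>(x, y). Poly_Mapping.single (x, y, b) 1) (d a)) u"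

definition comult_right ::
  "('h \<Rightarrow> ('h \<times> 'h \<Rightarrow>\<^sub>0 'k)) \<Rightarrow> ('h \<times> 'h \<Rightarrow>\<^sub>0 'k::field) \<Rightarrow> ('h \<times> 'h \<times> 'h \<Rightarrow>\<^sub>0 'k)" where
  "comult_right d u = free_extend free_scale
     (\<lambda>(a, b). free_extend free_scale (\<lambda>(x, y). Poly_Mapping.single (a, x, y) 1) (d b)) u"

definition tensor_mult ::
  "('h::ring_1 \<times> 'h \<Rightarrow>\<^sub>0 'k::field) \<Rightarrow> ('h \<times> 'h \<Rightarrow>\<^sub>0 'k) \<Rightarrow> ('h \<times> 'h \<Rightarrow>\<^sub>0 'k)" where
  "tensor_mult u v = free_extend free_scale
     (\<lambda>(a, b). free_extend free_scale (\<lambda>(a', b'). Poly_Mapping.single (a * a', b * b') 1) v) u"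

locale coalgebra = vector_space scale
  for scale :: "'k::field \<Rightarrow> 'h::ab_group_add \<Rightarrow> 'h" +
  fixes comult :: "'h \<Rightarrow> ('h \<times> 'h \<Rightarrow>\<^sub>0 'k) set"
    and counit :: "'h \<Rightarrow> 'k"
  assumes comult_in: "comult x \<in> tensor_square scale"
    and comult_add: "u \<in> comult x \<Longrightarrow> v \<in> comult y \<Longrightarrow> u + v \<in> comult (x + y)"
    and comult_scale: "u \<in> comult x \<Longrightarrow> free_scale c u \<in> comult (scale c x)"
    and counit_linear: "Vector_Spaces.linear scale (*) counit"
    and coassoc: "u \<in> comult x \<Longrightarrow> (\<And>a. d a \<in> comult a) \<Longrightarrow>
      (comult_left d u, comult_right d u) \<in> tensor3_rel scale"
    and counit_left: "u \<in> comult x \<Longrightarrow> free_extend scale (\<lambda>(a, b). scale (counit a) b) u = x"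
    and counit_right: "u \<in> comult x \<Longrightarrow> free_extend scale (\<lambda>(a, b). scale (counit b) a) u = x"

locale assoc_algebra = vector_space scale
  for scale :: "'k::field \<Rightarrow> 'h::ring_1 \<Rightarrow> 'h" +
  assumes scale_mult_left: "scale c x * y = scale c (x * y)"
    and scale_mult_right: "x * scale c y = scale c (x * y)"

locale bialgebra = assoc_algebra scale + coalgebra scale comult counit
  for scale :: "'k::field \<Rightarrow> 'h::ring_1 \<Rightarrow> 'h"
    and comult :: "'h \<Rightarrow> ('h \<times> 'h \<Rightarrow>\<^sub>0 'k) set"
    and counit :: "'h \<Rightarrow> 'k" +
  assumes comult_mult: "u \<in> comult x \<Longrightarrow> v \<in> comult y \<Longrightarrow> tensor_mult u v \<in> comult (x * y)"
    and comult_one: "Poly_Mapping.single (1, 1) 1 \<in> comult 1"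
    and counit_mult: "counit (x * y) = counit x * counit y"
    and counit_one: "counit 1 = 1"

locale hopf_algebra = bialgebra scale comult counit
  for scale :: "'k::field \<Rightarrow> 'h::ring_1 \<Rightarrow> 'h"
    and comult :: "'h \<Rightarrow> ('h \<times> 'h \<Rightarrow>\<^sub>0 'k) set"
    and counit :: "'h \<Rightarrow> 'k" +
  fixes antipode :: "'h \<Rightarrow> 'h"
  assumes antipode_linear: "Vector_Spaces.linear scale scale antipode"
    and antipode_left:
      "u \<in> comult x \<Longrightarrow> free_extend scale (\<lambda>(a, b). antipode a * b) u = scale (counit x) 1"
    and antipode_right:
      "u \<in> comult x \<Longrightarrow> free_extend scale (\<lambda>(a, b). a * antipode b) u = scale (counit x) 1"

text \<open>
  A subspace \<open>C\<close> is a subcoalgebra if \<open>\<Delta>(C)\<close> lies in the image of \<open>C \<otimes> C\<close> in \<open>H \<otimes> H\<close>, i.e. if the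
  coproduct of each element of \<open>C\<close> has an expression using only elements of \<open>C\<close>.
\<close>

definition subcoalgebra ::
  "('k::field \<Rightarrow> 'h::ab_group_add \<Rightarrow> 'h) \<Rightarrow> ('h \<Rightarrow> ('h \<times> 'h \<Rightarrow>\<^sub>0 'k) set) \<Rightarrow> 'h set \<Rightarrow> bool" where
  "subcoalgebra scale comult C \<longleftrightarrow>
     module.subspace scale C \<and>
     (\<forall>x\<in>C. \<exists>u\<in>comult x. Poly_Mapping.keys u \<subseteq> C \<times> C)"

definition simple_subcoalgebra ::
  "('k::field \<Rightarrow> 'h::ab_group_add \<Rightarrow> 'h) \<Rightarrow> ('h \<Rightarrow> ('h \<times> 'h \<Rightarrow>\<^sub>0 'k) set) \<Rightarrow> 'h set \<Rightarrow> bool" where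
  "simple_subcoalgebra scale comult C \<longleftrightarrow>
     subcoalgebra scale comult C \<and> C \<noteq> {0} \<and>
     (\<forall>D. subcoalgebra scale comult D \<and> D \<subseteq> C \<longrightarrow> D = {0} \<or> D = C)"

definition coradical ::
  "('k::field \<Rightarrow> 'h::ab_group_add \<Rightarrow> 'h) \<Rightarrow> ('h \<Rightarrow> ('h \<times> 'h \<Rightarrow>\<^sub>0 'k) set) \<Rightarrow> 'h set" where
  "coradical scale comult = module.span scale (\<Union>{C. simple_subcoalgebra scale comult C})"

end

theory Submission
  imports Defs
begin

text \<open>
  The theorem is a consequence of a statement about subalgebras: a subalgebra \<open>K\<close> of \<open>H\<close> that contains
  the image of the antipode and the coradical is all of \<open>H\<close> (\<open>subalgebra_eq_UNIV\<close>).  As \<open>S\<close> reverses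
  products, its image is such a \<open>K\<close>.

  Let \<open>D\<close> be the largest subcoalgebra inside \<open>K\<close>, and let \<open>D \<and> D\<close> be its wedge, the set of all \<open>x\<close>
  with \<open>\<Delta> x \<in> D \<otimes> H + H \<otimes> D\<close>.  Two facts are played against each other.

  First, \<open>D \<and> D \<subseteq> K\<close> (\<open>wedge_core_subset\<close>).  Choose a linear projection \<open>p\<close> of \<open>H\<close> onto \<open>K\<close> and put
  \<open>q = id - p\<close>, which vanishes on \<open>D\<close>.  For \<open>x \<in> D \<and> D\<close> each term of \<open>x\<^sub>1 \<otimes> x\<^sub>2 \<otimes> x\<^sub>3\<close> has its first or
  its last factor in \<open>D\<close>, and therefore \<open>0 = \<Sum> q(x\<^sub>1) S(x\<^sub>2) q(x\<^sub>3)\<close>.  Multiplied out, the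
  antipode axioms make this \<open>x - p(x) - p(x) + \<Sum> p(x\<^sub>1) S(x\<^sub>2) p(x\<^sub>3)\<close>, where everything except the
  first term lies in \<open>K\<close>; so \<open>x \<in> K\<close>.  Since \<open>D \<and> D\<close> is a subcoalgebra, \<open>D \<and> D \<subseteq> D\<close>.

  Secondly, a subcoalgebra \<open>D\<close> that contains the coradical and satisfies \<open>D \<and> D \<subseteq> D\<close> is everything
  (\<open>wedge_closed_eq_UNIV\<close>).  Otherwise choose \<open>x \<notin> D\<close> generating a right coideal of least possible
  dimension.  A functional \<open>f\<close> that kills \<open>D\<close> sends this right coideal, by \<open>y \<mapsto> \<Sum> f(y\<^sub>1) y\<^sub>2\<close>, to one that
  is zero or simple.  Simple right coideals lie in the coradical (\<open>coradical_if_simple_orbit\<close>), hence in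
  \<open>D\<close>, so that \<open>x \<in> D \<and> D \<subseteq> D\<close>, a contradiction.

  Coalgebra arguments are carried out with the two commuting actions of linear functionals on \<open>H\<close>,
  \<open>f \<rightharpoonup> x = \<Sum> x\<^sub>1 f(x\<^sub>2)\<close> and \<open>x \<leftharpoonup> g = \<Sum> g(x\<^sub>1) x\<^sub>2\<close>: right coideals are the subspaces stable under the
  first one, and subcoalgebras those stable under both.
\<close>

section \<open>Linear maps out of free vector spaces\<close>

lemma (in vector_space) free_extend_superset:
  assumes "finite A" "Poly_Mapping.keys u \<subseteq> A"
  shows "free_extend scale f u = (\<Sum>p\<in>A. scale (Poly_Mapping.lookup u p) (f p))"
  unfolding free_extend_def using assms
  by (intro sum.mono_neutral_left) (auto simp: in_keys_iff)

lemma (in vector_space) free_extend_linear: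
  "Vector_Spaces.linear free_scale scale (free_extend scale f)"
proof -
  interpret free: vector_space "free_scale :: 'a \<Rightarrow> ('c \<Rightarrow>\<^sub>0 'a) \<Rightarrow> _" by (rule vector_space_free_scale)
  show ?thesis
  proof (unfold_locales)
    fix u v :: "'c \<Rightarrow>\<^sub>0 'a" and c
    let ?A = "Poly_Mapping.keys u \<union> Poly_Mapping.keys v"
    have "Poly_Mapping.keys (u + v) \<subseteq> ?A" by (rule Poly_Mapping.keys_add)
    then show "free_extend scale f (u + v) = free_extend scale f u + free_extend scale f v"
      by (simp add: free_extend_superset[of ?A] lookup_add scale_left_distrib sum.distrib)
    have "Poly_Mapping.keys (free_scale c u) \<subseteq> Poly_Mapping.keys u"
      by (auto simp: in_keys_iff)
    then show "free_extend scale f (free_scale c u) = scale c (free_extend scale f u)"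
      by (simp add: free_extend_superset[of "Poly_Mapping.keys u"] scale_sum_right)
  qed
qed

lemma (in vector_space) free_extend_single [simp]:
  "free_extend scale f (Poly_Mapping.single p c) = scale c (f p)"
  by (simp add: free_extend_superset[of "{p}"])

lemma (in vector_space) free_extend_eq_mod_span:
  assumes "u - v \<in> module.span free_scale R" "\<And>r. r \<in> R \<Longrightarrow> free_extend scale f r = 0"
  shows "free_extend scale f u = free_extend scale f v"
proof -
  interpret L: Vector_Spaces.linear free_scale scale "free_extend scale f"
    by (rule free_extend_linear)
  have "free_extend scale f (u - v) = 0"
    using L.eq_0_on_span[OF assms(2,1)] by simp
  then show ?thesis by (simp add: L.diff)
qed

lemma linear_free_extend:
  assumes "Vector_Spaces.linear s t L"
  shows "L (free_extend s f u) = free_extend t (\<lambda>p. L (f p)) u"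
proof -
  interpret L: Vector_Spaces.linear s t L by fact
  show ?thesis by (simp add: free_extend_def L.sum L.scale)
qed


section \<open>Functionals and coordinates\<close>

context coalgebra
begin

abbreviation functional :: "('h \<Rightarrow> 'k) \<Rightarrow> bool" where
  "functional f \<equiv> Vector_Spaces.linear scale (*) f"

abbreviation endo :: "('h \<Rightarrow> 'h) \<Rightarrow> bool" where
  "endo q \<equiv> Vector_Spaces.linear scale scale q"

definition bilinear :: "('h \<Rightarrow> 'h \<Rightarrow> 'h) \<Rightarrow> bool" where
  "bilinear \<beta> \<longleftrightarrow> (\<forall>a. endo (\<beta> a)) \<and> (\<forall>b. endo (\<lambda>a. \<beta> a b))"

lemma endoI:
  "(\<And>x y. q (x + y) = q x + q y) \<Longrightarrow> (\<And>c x. q (scale c x) = scale c (q x)) \<Longrightarrow> endo q"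
  by unfold_locales

lemma endoD:
  assumes "endo q"
  shows "q (x + y) = q x + q y" "q (scale c x) = scale c (q x)" "q 0 = 0" "q (x - y) = q x - q y"
proof -
  interpret q: Vector_Spaces.linear scale scale q by fact
  show "q (x + y) = q x + q y" "q (scale c x) = scale c (q x)" "q 0 = 0" "q (x - y) = q x - q y"
    by (rule q.add q.scale q.zero q.diff)+
qed

lemma functionalI:
  "(\<And>x y. f (x + y) = f x + f y) \<Longrightarrow> (\<And>c x. f (scale c x) = c * f x) \<Longrightarrow> functional f"
  by unfold_locales (auto simp: algebra_simps)

lemma functionalD:
  assumes "functional f"
  shows "f (x + y) = f x + f y" "f (scale c x) = c * f x" "f 0 = 0" "f (x - y) = f x - f y"
proof -
  interpret f: Vector_Spaces.linear scale "(*)" f by fact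
  show "f (x + y) = f x + f y" "f (scale c x) = c * f x" "f 0 = 0" "f (x - y) = f x - f y"
    by (rule f.add f.scale f.zero f.diff)+
qed

lemma functional_compose: "functional f \<Longrightarrow> endo q \<Longrightarrow> functional (\<lambda>x. f (q x))"
  by (intro functionalI) (simp_all add: functionalD endoD)

lemma functional_add: "functional f \<Longrightarrow> functional g \<Longrightarrow> functional (\<lambda>x. f x + g x)"
  by (rule functionalI) (simp_all add: functionalD[of f] functionalD[of g] algebra_simps)

lemma functional_scale: "functional f \<Longrightarrow> functional (\<lambda>x. c * f x)"
  by (rule functionalI) (simp_all add: functionalD[of f] algebra_simps)

lemma endo_compose: "endo q \<Longrightarrow> endo r \<Longrightarrow> endo (\<lambda>x. q (r x))"
  by (intro endoI) (simp_all add: endoD)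

lemma endo_diff: "endo q \<Longrightarrow> endo r \<Longrightarrow> endo (\<lambda>x. q x - r x)"
  by (intro endoI) (simp_all add: endoD scale_right_diff_distrib)

lemma endo_id: "endo (\<lambda>x. x)"
  by (intro endoI) simp_all

lemma endo_scale_const: "functional f \<Longrightarrow> endo (\<lambda>x. scale (f x) v)"
  by (intro endoI) (simp_all add: functionalD scale_left_distrib)

lemma endo_scale: "endo q \<Longrightarrow> endo (\<lambda>x. scale c (q x))"
  by (intro endoI) (simp_all add: endoD scale_right_distrib ac_simps)

lemma bilinearI: "(\<And>a. endo (\<beta> a)) \<Longrightarrow> (\<And>b. endo (\<lambda>a. \<beta> a b)) \<Longrightarrow> bilinear \<beta>"
  by (simp add: bilinear_def)

lemma bilinearD: "bilinear \<beta> \<Longrightarrow> endo (\<beta> a)" "bilinear \<beta> \<Longrightarrow> endo (\<lambda>a. \<beta> a b)"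
  by (simp_all add: bilinear_def)

lemma functional_counit: "functional counit"
  by (rule counit_linear)

text \<open>Extending the empty independent set produces a basis of the whole space.\<close>

definition coord :: "'h \<Rightarrow> 'h \<Rightarrow> 'k" where
  "coord = representation (extend_basis {})"

lemma functional_coord: "functional (\<lambda>x. coord x b)"
  unfolding coord_def
  by (rule linear_representation)
    (simp_all add: independent_extend_basis[OF independent_empty] span_extend_basis[OF independent_empty])

lemma finite_coord: "finite {b. coord x b \<noteq> 0}"
  by (simp add: coord_def finite_representation)

lemma coord_expansion:
  assumes "finite I" "{b. coord x b \<noteq> 0} \<subseteq> I"
  shows "x = (\<Sum>b\<in>I. scale (coord x b) b)"
proof -
  have "(\<Sum>b | coord x b \<noteq> 0. scale (coord x b) b) = x"
    unfolding coord_def by (rule sum_nonzero_representation_eq)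
      (simp_all add: independent_extend_basis[OF independent_empty] span_extend_basis[OF independent_empty])
  moreover have "(\<Sum>b | coord x b \<noteq> 0. scale (coord x b) b) = (\<Sum>b\<in>I. scale (coord x b) b)"
    using assms by (intro sum.mono_neutral_left) auto
  ultimately show ?thesis by simp
qed

lemma eq_if_functionals_eq:
  assumes "\<And>f. functional f \<Longrightarrow> f x = f y"
  shows "x = y"
proof -
  have "coord x = coord y"
    using assms[OF functional_coord] by auto
  then show ?thesis
    using coord_expansion[OF finite_coord[of x] subset_refl]
      coord_expansion[OF finite_coord[of y] subset_refl] by simp
qed

lemma ex_projection:
  assumes "subspace V"
  obtains p where "endo p" "\<And>x. p x \<in> V" "\<And>x. x \<in> V \<Longrightarrow> p x = x"
proof -
  interpret vector_space_pair scale scale ..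
  obtain p where "p ` UNIV \<subseteq> V" "endo p" "\<forall>v\<in>V. p v = v"
    using linear_exists_left_inverse_on[OF endo_id assms] by auto
  then show ?thesis using that by blast
qed

text \<open>
  Functionals separate the points of a tensor product: if \<open>(f \<otimes> g)(\<Sum> c\<^sub>p A\<^sub>p \<otimes> B\<^sub>p) = 0\<close> for all
  \<open>f\<close> and \<open>g\<close>, then in particular all coordinates of this tensor with respect to a product basis
  vanish, and with them every expression obtained by expanding both factors in the basis.  The values
  \<open>\<gamma> i j\<close> on basis vectors are arbitrary, so that the lemma serves both for bilinear maps into \<open>H\<close> and
  for formal sums.
\<close>

lemma coordinate_sum_eq_0:
  fixes A B :: "'p \<Rightarrow> 'h" and \<gamma> :: "'h \<Rightarrow> 'h \<Rightarrow> 'v::ab_group_add"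
  assumes s: "vector_space s"
    and 0: "\<And>f g. functional f \<Longrightarrow> functional g \<Longrightarrow> (\<Sum>p\<in>P. c p * (f (A p) * g (B p))) = 0"
  shows "(\<Sum>p\<in>P. s (c p) (\<Sum>i\<in>I. \<Sum>j\<in>I. s (coord (A p) i * coord (B p) j) (\<gamma> i j))) = 0"
proof -
  interpret s: vector_space s by (rule s)
  have "(\<Sum>p\<in>P. s (c p) (\<Sum>i\<in>I. \<Sum>j\<in>I. s (coord (A p) i * coord (B p) j) (\<gamma> i j)))
      = (\<Sum>p\<in>P. \<Sum>i\<in>I. \<Sum>j\<in>I. s (c p * (coord (A p) i * coord (B p) j)) (\<gamma> i j))"
    by (simp add: s.scale_sum_right)
  also have "\<dots> = (\<Sum>i\<in>I. \<Sum>j\<in>I. \<Sum>p\<in>P. s (c p * (coord (A p) i * coord (B p) j)) (\<gamma> i j))"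
    by (subst sum.swap) (intro sum.cong refl sum.swap)
  also have "\<dots> = (\<Sum>i\<in>I. \<Sum>j\<in>I. s (\<Sum>p\<in>P. c p * (coord (A p) i * coord (B p) j)) (\<gamma> i j))"
    by (simp add: s.scale_sum_left)
  also have "\<dots> = 0"
    by (simp add: 0[OF functional_coord functional_coord])
  finally show ?thesis .
qed

lemma bilinear_sum_eq_0:
  assumes "bilinear \<beta>" "finite P"
    and 0: "\<And>f g. functional f \<Longrightarrow> functional g \<Longrightarrow> (\<Sum>p\<in>P. c p * (f (A p) * g (B p))) = 0"
  shows "(\<Sum>p\<in>P. scale (c p) (\<beta> (A p) (B p))) = 0"
proof -
  define I where "I = (\<Union>p\<in>P. {b. coord (A p) b \<noteq> 0} \<union> {b. coord (B p) b \<noteq> 0})"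
  have I: "finite I"
    using \<open>finite P\<close> by (auto simp: I_def finite_coord)
  have "\<beta> (A p) (B p) = (\<Sum>i\<in>I. \<Sum>j\<in>I. scale (coord (A p) i * coord (B p) j) (\<beta> i j))"
    if p: "p \<in> P" for p
  proof -
    have "{b. coord (A p) b \<noteq> 0} \<subseteq> I" "{b. coord (B p) b \<noteq> 0} \<subseteq> I"
      using p by (auto simp: I_def)
    note A = coord_expansion[OF I this(1)] and B = coord_expansion[OF I this(2)]
    interpret r: Vector_Spaces.linear scale scale "\<lambda>a. \<beta> a (B p)"
      by (rule bilinearD[OF assms(1)])
    have l: "\<beta> a (\<Sum>i\<in>I. scale (coord (B p) i) i) = (\<Sum>i\<in>I. scale (coord (B p) i) (\<beta> a i))" for a
    proof -
      interpret l: Vector_Spaces.linear scale scale "\<beta> a"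
        by (rule bilinearD[OF assms(1)])
      show ?thesis by (simp add: l.sum l.scale)
    qed
    have "\<beta> (A p) (B p) = (\<Sum>i\<in>I. scale (coord (A p) i) (\<beta> i (B p)))"
      by (subst A) (simp add: r.sum r.scale)
    also have "\<dots> = (\<Sum>i\<in>I. \<Sum>j\<in>I. scale (coord (A p) i * coord (B p) j) (\<beta> i j))"
      by (subst B) (simp add: l scale_sum_right)
    finally show ?thesis .
  qed
  then have "(\<Sum>p\<in>P. scale (c p) (\<beta> (A p) (B p))) = (\<Sum>p\<in>P. scale (c p)
      (\<Sum>i\<in>I. \<Sum>j\<in>I. scale (coord (A p) i * coord (B p) j) (\<beta> i j)))"
    by simp
  also have "\<dots> = 0"
    by (rule coordinate_sum_eq_0[OF vector_space_axioms 0])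
  finally show ?thesis .
qed


section \<open>Sweedler sums\<close>

text \<open>
  The tensor \<open>\<Delta> x\<close> is a class of formal sums; the representative chosen here is immaterial as soon as a
  bilinear map is applied to it (\<open>sweedler_eq\<close>).
\<close>

definition cop :: "'h \<Rightarrow> ('h \<times> 'h \<Rightarrow>\<^sub>0 'k)" where
  "cop x = (SOME u. u \<in> comult x)"

text \<open>The element that is written \<open>\<Sum> \<beta>(x\<^sub>1, x\<^sub>2)\<close> in Sweedler notation.\<close>

definition sweedler :: "('h \<Rightarrow> 'h \<Rightarrow> 'h) \<Rightarrow> 'h \<Rightarrow> 'h" where
  "sweedler \<beta> x = free_extend scale (\<lambda>(a, b). \<beta> a b) (cop x)"

lemma cop_in_comult: "cop x \<in> comult x"
proof -
  have "comult x \<noteq> {}"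
    using in_quotient_imp_non_empty[OF equiv_tensor_rel comult_in[unfolded tensor_square_def]] .
  then show ?thesis
    unfolding cop_def some_in_eq .
qed

lemma comult_closed: "u \<in> comult x \<Longrightarrow> (u, v) \<in> tensor_rel scale \<Longrightarrow> v \<in> comult x"
  by (rule in_quotient_imp_closed[OF equiv_tensor_rel comult_in[unfolded tensor_square_def]])

lemma comult_related: "u \<in> comult x \<Longrightarrow> v \<in> comult x \<Longrightarrow> (u, v) \<in> tensor_rel scale"
  by (rule in_quotient_imp_in_rel[OF equiv_tensor_rel comult_in[unfolded tensor_square_def]]) simp

lemma free_extend_diff: "free_extend scale f (u - v) = free_extend scale f u - free_extend scale f v"
proof -
  interpret L: Vector_Spaces.linear free_scale scale "free_extend scale f"
    by (rule free_extend_linear)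
  show ?thesis by (rule L.diff)
qed

lemma sweedler_eq:
  assumes "bilinear \<beta>" "u \<in> comult x"
  shows "sweedler \<beta> x = free_extend scale (\<lambda>(a, b). \<beta> a b) u"
  unfolding sweedler_def
proof (rule free_extend_eq_mod_span)
  show "cop x - u \<in> module.span free_scale (bilinear_relations scale)"
    using comult_related[OF cop_in_comult assms(2)] by (simp add: tensor_rel_def)
  show "free_extend scale (\<lambda>(a, b). \<beta> a b) r = 0" if "r \<in> bilinear_relations scale" for r
    using that endoD[OF bilinearD(1)[OF assms(1)]] endoD[OF bilinearD(2)[OF assms(1)]]
    by (auto simp: bilinear_relations_def free_extend_diff)
qed

lemma endo_sweedler:
  assumes "bilinear \<beta>"
  shows "endo (sweedler \<beta>)"
proof (rule endoI)
  interpret L: Vector_Spaces.linear free_scale scale "free_extend scale (\<lambda>(a, b). \<beta> a b)"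
    by (rule free_extend_linear)
  show "sweedler \<beta> (x + y) = sweedler \<beta> x + sweedler \<beta> y" for x y
    using sweedler_eq[OF assms comult_add[OF cop_in_comult cop_in_comult]]
    by (simp add: L.add sweedler_def)
  show "sweedler \<beta> (scale c x) = scale c (sweedler \<beta> x)" for c x
    using sweedler_eq[OF assms comult_scale[OF cop_in_comult]]
    by (simp add: L.scale sweedler_def)
qed

lemma functional_apply_sweedler:
  "functional f \<Longrightarrow> f (sweedler \<beta> x) =
    (\<Sum>p\<in>Poly_Mapping.keys (cop x). Poly_Mapping.lookup (cop x) p * f (\<beta> (fst p) (snd p)))"
  by (simp add: sweedler_def linear_free_extend[of scale "(*)" f])
    (simp add: free_extend_def case_prod_unfold)

lemma endo_apply_sweedler: "endo q \<Longrightarrow> q (sweedler \<beta> x) = sweedler (\<lambda>a b. q (\<beta> a b)) x"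
  by (simp add: sweedler_def linear_free_extend[of scale scale q] case_prod_unfold)

lemma sweedler_diff:
  "sweedler (\<lambda>a b. \<beta> a b - \<gamma> a b) x = sweedler \<beta> x - sweedler \<gamma> x"
  by (simp add: sweedler_def free_extend_def case_prod_unfold scale_right_diff_distrib sum_subtractf)

lemma sweedler_swap:
  "sweedler (\<lambda>a b. sweedler (\<lambda>c d. \<tau> a b c d) y) x = sweedler (\<lambda>c d. sweedler (\<lambda>a b. \<tau> a b c d) x) y"
  unfolding sweedler_def free_extend_def case_prod_unfold scale_sum_right
  by (subst sum.swap) (simp add: mult.commute)

lemma endo_sweedler_param:
  assumes "\<And>a b. endo (\<lambda>y. \<tau> y a b)"
  shows "endo (\<lambda>y. sweedler (\<tau> y) x)"
  by (rule endoI) (simp_all add: endoD(1,2)[OF assms] sweedler_def free_extend_def case_prod_unfold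
      scale_right_distrib sum.distrib scale_sum_right mult.commute)

lemma sweedler_mem:
  assumes "subspace V" "\<And>a b. \<beta> a b \<in> V"
  shows "sweedler \<beta> x \<in> V"
  unfolding sweedler_def free_extend_def using assms
  by (intro subspace_sum) (auto intro: subspace_scale)

text \<open>
  Both sides are \<open>\<Sum> \<tau>(x\<^sub>1, x\<^sub>2, x\<^sub>3)\<close>; trilinearity lets \<open>\<tau>\<close> pass to the quotient in which coassociativity
  is an equation.
\<close>

lemma sweedler_coassoc:
  assumes "\<And>a b. endo (\<lambda>c. \<tau> a b c)" "\<And>a c. endo (\<lambda>b. \<tau> a b c)" "\<And>b c. endo (\<lambda>a. \<tau> a b c)"
  shows "sweedler (\<lambda>a c. sweedler (\<lambda>a b. \<tau> a b c) a) x = sweedler (\<lambda>a b. sweedler (\<tau> a) b) x"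
proof -
  let ?T = "free_extend scale (\<lambda>p. \<tau> (fst p) (fst (snd p)) (snd (snd p)))"
  note T = linear_free_extend[of free_scale scale ?T, OF free_extend_linear]
  have "?T (comult_left cop (cop x)) = ?T (comult_right cop (cop x))"
  proof (rule free_extend_eq_mod_span)
    show "comult_left cop (cop x) - comult_right cop (cop x)
        \<in> module.span free_scale (trilinear_relations scale)"
      using coassoc[OF cop_in_comult cop_in_comult, of x] by (simp add: tensor3_rel_def)
    show "?T r = 0" if "r \<in> trilinear_relations scale" for r
      using that endoD[OF assms(1)] endoD[OF assms(2)] endoD[OF assms(3)]
      by (auto simp: trilinear_relations_def free_extend_diff)
  qed
  then show ?thesis
    by (simp add: comult_left_def comult_right_def T sweedler_def case_prod_unfold)
qed

lemma sweedler_counit: "sweedler (\<lambda>a b. scale (counit a) b) x = x"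
    "sweedler (\<lambda>a b. scale (counit b) a) x = x"
  by (simp_all add: sweedler_def counit_left[OF cop_in_comult] counit_right[OF cop_in_comult])

section \<open>The two actions of functionals\<close>

definition hit_left :: "('h \<Rightarrow> 'k) \<Rightarrow> 'h \<Rightarrow> 'h"  (infixr "\<rightharpoonup>" 75) where
  "f \<rightharpoonup> x = sweedler (\<lambda>a b. scale (f b) a) x"

definition hit_right :: "'h \<Rightarrow> ('h \<Rightarrow> 'k) \<Rightarrow> 'h"  (infixl "\<leftharpoonup>" 75) where
  "x \<leftharpoonup> g = sweedler (\<lambda>a b. scale (g a) b) x"

lemma endo_hit_left: "functional f \<Longrightarrow> endo (\<lambda>x. f \<rightharpoonup> x)"
  unfolding hit_left_def
  by (intro endo_sweedler bilinearI) (simp_all add: endo_scale[OF endo_id] endo_scale_const)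

lemma endo_hit_right: "functional g \<Longrightarrow> endo (\<lambda>x. x \<leftharpoonup> g)"
  unfolding hit_right_def
  by (intro endo_sweedler bilinearI) (simp_all add: endo_scale[OF endo_id] endo_scale_const)

lemma hit_adjoint: "functional f \<Longrightarrow> functional g \<Longrightarrow> f (x \<leftharpoonup> g) = g (f \<rightharpoonup> x)"
  unfolding hit_left_def hit_right_def
  by (simp add: functional_apply_sweedler functionalD[of f] functionalD[of g] ac_simps)

lemma hit_counit [simp]: "counit \<rightharpoonup> x = x" "x \<leftharpoonup> counit = x"
  by (simp_all add: hit_left_def hit_right_def sweedler_counit)

lemma counit_hit_left: "functional f \<Longrightarrow> counit (f \<rightharpoonup> x) = f x"
  using hit_adjoint[OF _ functional_counit, of f x] by simp

lemma hit_commute: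
  assumes f: "functional f" and g: "functional g"
  shows "(f \<rightharpoonup> x) \<leftharpoonup> g = f \<rightharpoonup> (x \<leftharpoonup> g)"
proof -
  have "(f \<rightharpoonup> x) \<leftharpoonup> g = sweedler (\<lambda>a c. sweedler (\<lambda>a b. scale (f c) (scale (g a) b)) a) x"
    unfolding hit_left_def[of f x]
    by (simp add: endo_apply_sweedler[OF endo_hit_right[OF g]] endoD[OF endo_hit_right[OF g]])
      (simp add: hit_right_def endo_apply_sweedler[OF endo_scale[OF endo_id]])
  also have "\<dots> = sweedler (\<lambda>a b. sweedler (\<lambda>b c. scale (f c) (scale (g a) b)) b) x"
    by (rule sweedler_coassoc) (intro endoI; simp add: scale_right_distrib scale_left_distrib functionalD[OF f] functionalD[OF g] algebra_simps)+
  also have "\<dots> = f \<rightharpoonup> (x \<leftharpoonup> g)"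
    unfolding hit_right_def
    by (simp add: endo_apply_sweedler[OF endo_hit_left[OF f]] endoD[OF endo_hit_left[OF f]])
      (simp add: hit_left_def endo_apply_sweedler[OF endo_scale[OF endo_id]] ac_simps)
  finally show ?thesis .
qed

text \<open>
  The functional on the right-hand side is the convolution product \<open>\<Sum> g(a\<^sub>1) f(a\<^sub>2)\<close>, written without an
  explicit product on functionals.
\<close>

lemma hit_right_hit_right:
  assumes f: "functional f" and g: "functional g"
  shows "(x \<leftharpoonup> g) \<leftharpoonup> f = x \<leftharpoonup> (\<lambda>a. f (a \<leftharpoonup> g))"
proof -
  have "x \<leftharpoonup> (\<lambda>a. f (a \<leftharpoonup> g)) = sweedler (\<lambda>a c. sweedler (\<lambda>a b. scale (f (scale (g a) b)) c) a) x"
    unfolding hit_right_def endo_apply_sweedler[OF endo_scale_const[OF f]] ..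
  also have "\<dots> = sweedler (\<lambda>a b. sweedler (\<lambda>b c. scale (f (scale (g a) b)) c) b) x"
    by (rule sweedler_coassoc) (intro endoI; simp add: scale_right_distrib scale_left_distrib functionalD[OF f] functionalD[OF g] algebra_simps)+
  also have "\<dots> = (x \<leftharpoonup> g) \<leftharpoonup> f"
    unfolding hit_right_def[of x g]
    by (simp add: endo_apply_sweedler[OF endo_hit_right[OF f]] endoD[OF endo_hit_right[OF f]])
      (simp add: hit_right_def endo_apply_sweedler[OF endo_scale[OF endo_id]] functionalD[OF f])
  finally show ?thesis by simp
qed

lemma hit_left_hit_left:
  assumes f: "functional f" and g: "functional g"
  shows "f \<rightharpoonup> (g \<rightharpoonup> x) = (\<lambda>b. f (g \<rightharpoonup> b)) \<rightharpoonup> x"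
proof -
  have "f \<rightharpoonup> (g \<rightharpoonup> x) = sweedler (\<lambda>a c. sweedler (\<lambda>a b. scale (f (scale (g c) b)) a) a) x"
    unfolding hit_left_def[of g x]
    by (simp add: endo_apply_sweedler[OF endo_hit_left[OF f]] endoD[OF endo_hit_left[OF f]])
      (simp add: hit_left_def endo_apply_sweedler[OF endo_scale[OF endo_id]] functionalD[OF f])
  also have "\<dots> = sweedler (\<lambda>a b. sweedler (\<lambda>b c. scale (f (scale (g c) b)) a) b) x"
    by (rule sweedler_coassoc) (intro endoI; simp add: scale_right_distrib scale_left_distrib functionalD[OF f] functionalD[OF g] algebra_simps)+
  also have "\<dots> = (\<lambda>b. f (g \<rightharpoonup> b)) \<rightharpoonup> x"
    unfolding hit_left_def endo_apply_sweedler[OF endo_scale_const[OF f]] ..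
  finally show ?thesis .
qed

lemma hit_left_add: "f \<rightharpoonup> x + g \<rightharpoonup> x = (\<lambda>b. f b + g b) \<rightharpoonup> x"
  by (simp add: hit_left_def sweedler_def free_extend_def case_prod_unfold scale_left_distrib
      scale_right_distrib sum.distrib)

lemma hit_left_scale: "scale c (f \<rightharpoonup> x) = (\<lambda>b. c * f b) \<rightharpoonup> x"
  by (simp add: hit_left_def sweedler_def free_extend_def case_prod_unfold scale_sum_right ac_simps)

text \<open>
  A tensor \<open>\<Sum> q(x\<^sub>1) \<otimes> r(x\<^sub>2)\<close> is zero once all its contractions \<open>\<Sum> f(q(x\<^sub>1)) r(x\<^sub>2)\<close> in the first factor
  are.  In this form a vanishing condition on a linear map and membership of the elements
  \<open>x \<leftharpoonup> f\<close> in a subspace can be combined.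
\<close>

lemma sweedler_eq_0:
  assumes "bilinear \<beta>" "endo q" "endo r"
    and 0: "\<And>f. functional f \<Longrightarrow> r (x \<leftharpoonup> (\<lambda>a. f (q a))) = 0"
  shows "sweedler (\<lambda>a b. \<beta> (q a) (r b)) x = 0"
proof -
  have "(\<Sum>p\<in>Poly_Mapping.keys (cop x). scale (Poly_Mapping.lookup (cop x) p)
      (\<beta> (q (fst p)) (r (snd p)))) = 0"
  proof (rule bilinear_sum_eq_0[OF assms(1)])
    fix f g assume f: "functional f" and g: "functional g"
    have "functional (\<lambda>b. g (r b))"
      by (rule functional_compose[OF g \<open>endo r\<close>])
    then have "g (r (x \<leftharpoonup> (\<lambda>a. f (q a)))) = (\<Sum>p\<in>Poly_Mapping.keys (cop x).
        Poly_Mapping.lookup (cop x) p * (f (q (fst p)) * g (r (snd p))))"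
      unfolding hit_right_def
      by (simp add: functional_apply_sweedler[of "\<lambda>b. g (r b)"] functionalD[of "\<lambda>b. g (r b)"])
    then show "(\<Sum>p\<in>Poly_Mapping.keys (cop x).
        Poly_Mapping.lookup (cop x) p * (f (q (fst p)) * g (r (snd p)))) = 0"
      using 0[OF f] functionalD[OF g] by simp
  qed simp
  then show ?thesis
    by (simp add: sweedler_def free_extend_def case_prod_unfold)
qed


section \<open>Subcoalgebras as stable subspaces\<close>

definition stable :: "'h set \<Rightarrow> bool" where
  "stable C \<longleftrightarrow> subspace C \<and> (\<forall>x\<in>C. \<forall>f. functional f \<longrightarrow> f \<rightharpoonup> x \<in> C \<and> x \<leftharpoonup> f \<in> C)"

lemma stableD:
  assumes "stable C"
  shows "subspace C" "x \<in> C \<Longrightarrow> functional f \<Longrightarrow> f \<rightharpoonup> x \<in> C"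
    "x \<in> C \<Longrightarrow> functional f \<Longrightarrow> x \<leftharpoonup> f \<in> C"
  using assms by (auto simp: stable_def)

lemma stable_if_subcoalgebra:
  assumes "subcoalgebra scale comult C"
  shows "stable C"
  unfolding stable_def
proof (intro conjI ballI allI impI)
  show C: "subspace C"
    using assms by (simp add: subcoalgebra_def)
  fix x f assume "x \<in> C" and f: "functional f"
  then obtain u where u: "u \<in> comult x" "Poly_Mapping.keys u \<subseteq> C \<times> C"
    using assms by (auto simp: subcoalgebra_def)
  have "bilinear (\<lambda>a b. scale (f b) a)" "bilinear (\<lambda>a b. scale (f a) b)"
    by (intro bilinearI; simp add: endo_scale[OF endo_id] endo_scale_const f)+
  note eq = this[THEN sweedler_eq, OF u(1)]
  show "f \<rightharpoonup> x \<in> C" "x \<leftharpoonup> f \<in> C"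
    unfolding hit_left_def hit_right_def eq free_extend_def using u(2)
    by (auto intro!: subspace_sum[OF C] subspace_scale[OF C])
qed

text \<open>
  Formal sums become linear in each factor only modulo the bilinearity relations; this extends such
  linearity modulo a subspace to finite linear combinations.
\<close>

lemma linear_mod_sum:
  fixes \<Phi> :: "'h \<Rightarrow> 'v::ab_group_add"
  assumes "vector_space t" "module.subspace t U"
    and add: "\<And>a a'. \<Phi> (a + a') - \<Phi> a - \<Phi> a' \<in> U"
    and scale: "\<And>c a. \<Phi> (scale c a) - t c (\<Phi> a) \<in> U"
  shows "\<Phi> (\<Sum>i\<in>I. scale (c i) (v i)) - (\<Sum>i\<in>I. t (c i) (\<Phi> (v i))) \<in> U"
proof -
  interpret t: vector_space t by fact
  have zero: "\<Phi> 0 \<in> U"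
    using t.subspace_neg[OF assms(2) add[of 0 0]] by simp
  show ?thesis
  proof (induction I rule: infinite_finite_induct)
    case (insert i I)
    show ?case
      using t.subspace_add[OF assms(2) t.subspace_add[OF assms(2) insert(3)
          add[of "scale (c i) (v i)" "\<Sum>i\<in>I. scale (c i) (v i)"]] scale[of "c i" "v i"]] insert(1,2)
      by (simp add: algebra_simps)
  qed (use zero in simp_all)
qed

lemma tensor_expansion:
  assumes "finite I" "{i. coord a i \<noteq> 0} \<subseteq> I" "{i. coord b i \<noteq> 0} \<subseteq> I"
  shows "Poly_Mapping.single (a, b) 1 - (\<Sum>i\<in>I. \<Sum>j\<in>I.
      free_scale (coord a i * coord b j) (Poly_Mapping.single (i, j) 1))
    \<in> module.span free_scale (bilinear_relations scale)" (is "?e \<in> ?U")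
proof -
  interpret free: vector_space "free_scale :: 'k \<Rightarrow> ('h \<times> 'h \<Rightarrow>\<^sub>0 'k) \<Rightarrow> _"
    by (rule vector_space_free_scale)
  have fs: "free_scale c (Poly_Mapping.single p 1) = Poly_Mapping.single p c" for c :: 'k and p :: "'h \<times> 'h"
    by (rule poly_mapping_eqI) (simp add: lookup_single when_def)
  have U: "free.subspace ?U" by (rule free.subspace_span)
  have rel: "r \<in> bilinear_relations scale \<Longrightarrow> r \<in> ?U" for r
    by (rule free.span_base)
  have "Poly_Mapping.single (\<Sum>i\<in>I. scale (coord a i) i, b) 1
      - (\<Sum>i\<in>I. free_scale (coord a i) (Poly_Mapping.single (i, b) 1)) \<in> ?U"
    by (rule linear_mod_sum[OF vector_space_free_scale U, of "\<lambda>a. Poly_Mapping.single (a, b) 1"];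
        rule rel; unfold bilinear_relations_def fs; blast)
  moreover have "(\<Sum>i\<in>I. free_scale (coord a i) (Poly_Mapping.single (i, \<Sum>j\<in>I. scale (coord b j) j) 1
      - (\<Sum>j\<in>I. free_scale (coord b j) (Poly_Mapping.single (i, j) 1)))) \<in> ?U"
    by (rule free.span_sum, rule free.span_scale,
        rule linear_mod_sum[OF vector_space_free_scale U, of "\<lambda>b. Poly_Mapping.single (_, b) 1"];
        rule rel; unfold bilinear_relations_def fs; blast)
  ultimately have "Poly_Mapping.single (a, b) 1
      - (\<Sum>i\<in>I. free_scale (coord a i) (Poly_Mapping.single (i, b) 1))
      + (\<Sum>i\<in>I. free_scale (coord a i) (Poly_Mapping.single (i, b) 1
      - (\<Sum>j\<in>I. free_scale (coord b j) (Poly_Mapping.single (i, j) 1)))) \<in> ?U"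
    unfolding coord_expansion[OF assms(1,2), symmetric] coord_expansion[OF assms(1,3), symmetric]
    by (rule free.span_add)
  then show ?thesis
    by (simp add: free.scale_right_diff_distrib free.scale_sum_right sum_subtractf)
qed

text \<open>
  Functionals detect equality in \<open>H \<otimes> H\<close>: modulo the bilinearity relations \<open>w\<close> equals its expansion in
  a product basis, and the coefficients of that expansion are values of \<open>f \<otimes> g\<close> for coordinate functionals.
\<close>

lemma tensor_eq_0_if_functionals:
  assumes "\<And>f g. functional f \<Longrightarrow> functional g \<Longrightarrow> free_extend (*) (\<lambda>(a, b). f a * g b) w = 0"
  shows "w \<in> module.span free_scale (bilinear_relations scale)" (is "_ \<in> ?U")
proof -
  interpret free: vector_space "free_scale :: 'k \<Rightarrow> ('h \<times> 'h \<Rightarrow>\<^sub>0 'k) \<Rightarrow> _"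
    by (rule vector_space_free_scale)
  let ?P = "Poly_Mapping.keys w" and ?c = "Poly_Mapping.lookup w"
  define I where "I = (\<Union>p\<in>?P. {b. coord (fst p) b \<noteq> 0} \<union> {b. coord (snd p) b \<noteq> 0})"
  have I: "finite I"
    by (auto simp: I_def finite_coord)
  let ?e = "\<lambda>p. \<Sum>i\<in>I. \<Sum>j\<in>I. free_scale (coord (fst p) i * coord (snd p) j) (Poly_Mapping.single (i, j) 1)"
  have "(\<Sum>p\<in>?P. free_scale (?c p) (Poly_Mapping.single (fst p, snd p) 1 - ?e p)) \<in> ?U"
  proof (rule free.span_sum, rule free.span_scale, rule tensor_expansion[OF I])
    fix p assume "p \<in> ?P"
    then show "{b. coord (fst p) b \<noteq> 0} \<subseteq> I" "{b. coord (snd p) b \<noteq> 0} \<subseteq> I"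
      by (auto simp: I_def)
  qed
  moreover have "(\<Sum>p\<in>?P. free_scale (?c p) (?e p)) = 0"
    by (rule coordinate_sum_eq_0[OF vector_space_free_scale],
        drule (1) assms, simp add: free_extend_def case_prod_unfold)
  moreover have "(\<Sum>p\<in>?P. free_scale (?c p) (Poly_Mapping.single p 1)) = w"
  proof (rule poly_mapping_eqI)
    fix q
    have "(\<Sum>p\<in>?P. ?c p * (1 when p = q)) = (\<Sum>p\<in>?P. if p = q then ?c p else 0)"
      by (intro sum.cong) (auto simp: when_def)
    also have "\<dots> = ?c q"
      by (simp add: in_keys_iff)
    finally show "Poly_Mapping.lookup (\<Sum>p\<in>?P. free_scale (?c p) (Poly_Mapping.single p 1)) q = ?c q"
      by (simp add: lookup_sum lookup_single)
  qed
  ultimately show ?thesis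
    by (simp add: free.scale_right_diff_distrib sum_subtractf)
qed

text \<open>
  This is \<open>(C \<otimes> H) \<inter> (H \<otimes> C) = C \<otimes> C\<close> in disguise.  A projection \<open>p\<close> onto \<open>C\<close> provides the
  representative \<open>(p \<otimes> p)(\<Delta> x)\<close> with entries in \<open>C\<close>; it represents \<open>\<Delta> x\<close> because no pair of
  functionals distinguishes the two: \<open>p\<close> fixes \<open>x \<leftharpoonup> f\<close> and \<open>g \<rightharpoonup> x\<close>, which lie in \<open>C\<close>.
\<close>

lemma subcoalgebra_if_stable:
  assumes "stable C"
  shows "subcoalgebra scale comult C"
  unfolding subcoalgebra_def
proof (intro conjI ballI)
  show C: "subspace C"
    by (rule stableD[OF assms])
  fix x assume x: "x \<in> C"
  obtain p where p: "endo p" "\<And>x. p x \<in> C" "\<And>x. x \<in> C \<Longrightarrow> p x = x"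
    using ex_projection[OF C] by blast
  interpret free: vector_space "free_scale :: 'k \<Rightarrow> ('h \<times> 'h \<Rightarrow>\<^sub>0 'k) \<Rightarrow> _"
    by (rule vector_space_free_scale)
  define u where "u = free_extend free_scale (\<lambda>(a, b). Poly_Mapping.single (p a, p b) 1) (cop x)"
  have "Poly_Mapping.keys u \<subseteq> C \<times> C"
    unfolding u_def free_extend_def
  proof (rule order_trans[OF keys_sum], rule UN_least)
    fix q
    show "Poly_Mapping.keys (free_scale (Poly_Mapping.lookup (cop x) q)
        (case q of (a, b) \<Rightarrow> Poly_Mapping.single (p a, p b) 1)) \<subseteq> C \<times> C"
      using p(2) by (cases q) (auto simp: in_keys_iff lookup_single when_def split: if_splits)
  qed
  moreover have "u \<in> comult x"
  proof (rule comult_closed[OF cop_in_comult])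
    have "free_extend (*) (\<lambda>(a, b). f a * g b) (cop x - u) = 0"
      if f: "functional f" and g: "functional g" for f g
    proof -
      have k: "vector_space ((*) :: 'k \<Rightarrow> 'k \<Rightarrow> 'k)"
        by unfold_locales (simp_all add: algebra_simps)
      let ?E = "free_extend (*) (\<lambda>(a, b). f a * g b)"
      interpret E: Vector_Spaces.linear free_scale "(*)" ?E
        by (rule vector_space.free_extend_linear[OF k])
      have fp: "functional (\<lambda>x. f (p x))" and gp: "functional (\<lambda>x. g (p x))"
        by (rule functional_compose[OF f p(1)], rule functional_compose[OF g p(1)])
      have cop: "free_extend (*) (\<lambda>(a, b). f' a * g' b) (cop x) = g' (x \<leftharpoonup> f')"
        if "functional g'" for f' g'
        unfolding hit_right_def
        by (simp only: functional_apply_sweedler[OF that] functionalD(2)[OF that] free_extend_def case_prod_unfold)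
      have "?E u = free_extend (*) (\<lambda>(a, b). f (p a) * g (p b)) (cop x)"
        unfolding u_def linear_free_extend[OF E.linear_axioms]
        unfolding case_prod_unfold vector_space.free_extend_single[OF k] by simp
      \<comment> \<open>The projection is removed from one tensor factor at a time, by passing to the other action.\<close>
      also have "\<dots> = g (p (x \<leftharpoonup> (\<lambda>a. f (p a))))"
        by (rule cop[OF gp])
      also have "p (x \<leftharpoonup> (\<lambda>a. f (p a))) = x \<leftharpoonup> (\<lambda>a. f (p a))"
        by (rule p(3)[OF stableD(3)[OF assms x fp]])
      also have "g (x \<leftharpoonup> (\<lambda>a. f (p a))) = f (p (g \<rightharpoonup> x))"
        by (rule hit_adjoint[OF g fp])
      also have "p (g \<rightharpoonup> x) = g \<rightharpoonup> x"
        by (rule p(3)[OF stableD(2)[OF assms x g]])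
      also have "f (g \<rightharpoonup> x) = ?E (cop x)"
        unfolding cop[OF g] by (rule hit_adjoint[OF g f, symmetric])
      finally have eq: "?E u = ?E (cop x)" .
      show ?thesis
        unfolding E.diff eq by (rule diff_self)
    qed
    then have "cop x - u \<in> module.span free_scale (bilinear_relations scale)"
      by (rule tensor_eq_0_if_functionals)
    then show "(cop x, u) \<in> tensor_rel scale"
      unfolding tensor_rel_def by simp
  qed
  ultimately show "\<exists>u\<in>comult x. Poly_Mapping.keys u \<subseteq> C \<times> C" by blast
qed


section \<open>Simple right coideals lie in the coradical\<close>

text \<open>The right coideal generated by \<open>x\<close>.\<close>

definition orbit :: "'h \<Rightarrow> 'h set" where
  "orbit x = {f \<rightharpoonup> x | f. functional f}"

lemma orbitI: "functional f \<Longrightarrow> f \<rightharpoonup> x \<in> orbit x"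
  by (auto simp: orbit_def)

lemma orbitE:
  assumes "y \<in> orbit x"
  obtains f where "functional f" "y = f \<rightharpoonup> x"
  using assms by (auto simp: orbit_def)

lemma self_in_orbit: "x \<in> orbit x"
  using orbitI[OF functional_counit, of x] by simp

lemma subspace_orbit: "subspace (orbit x)"
proof (rule subspaceI)
  have "functional (\<lambda>_. 0)" by (rule functionalI) simp_all
  from orbitI[OF this, of x] show "0 \<in> orbit x"
    by (simp add: hit_left_def sweedler_def free_extend_def case_prod_unfold)
  show "v + w \<in> orbit x" if "v \<in> orbit x" "w \<in> orbit x" for v w
    using that by (elim orbitE) (simp add: hit_left_add orbitI functional_add)
  show "scale c v \<in> orbit x" if "v \<in> orbit x" for c v
    using that by (elim orbitE) (simp add: hit_left_scale orbitI functional_scale)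
qed

lemma hit_left_in_orbit:
  assumes "y \<in> orbit x" "functional f"
  shows "f \<rightharpoonup> y \<in> orbit x"
  using assms(1)
proof (rule orbitE)
  fix g assume g: "functional g" "y = g \<rightharpoonup> x"
  show ?thesis
    unfolding g(2) hit_left_hit_left[OF assms(2) g(1)]
    by (rule orbitI) (rule functional_compose[OF assms(2) endo_hit_left[OF g(1)]])
qed

lemma orbit_subset: "y \<in> orbit x \<Longrightarrow> orbit y \<subseteq> orbit x"
  using hit_left_in_orbit by (auto elim: orbitE)

lemma orbit_subset_stable: "stable C \<Longrightarrow> x \<in> C \<Longrightarrow> orbit x \<subseteq> C"
  using stableD(2) by (auto elim: orbitE)

lemma orbit_finitely_spanned: "orbit x \<subseteq> span (fst ` Poly_Mapping.keys (cop x))"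
proof
  fix y assume "y \<in> orbit x"
  then show "y \<in> span (fst ` Poly_Mapping.keys (cop x))"
  proof (rule orbitE)
    fix f assume "y = f \<rightharpoonup> x"
    then show ?thesis
      unfolding hit_left_def sweedler_def free_extend_def case_prod_unfold
      by (simp only:) (intro span_sum span_scale span_base imageI)
  qed
qed

text \<open>
  Under the hypothesis \<open>f \<rightharpoonup> z \<mapsto> f y\<close> is a well-defined linear form on the right coideal generated by
  \<open>z\<close>.  Any extension \<open>g\<close> of it satisfies \<open>f (z \<leftharpoonup> g) = g (f \<rightharpoonup> z) = f y\<close> for all \<open>f\<close>.
\<close>

lemma hit_right_eqI:
  assumes z: "\<And>f. functional f \<Longrightarrow> f \<rightharpoonup> z = 0 \<Longrightarrow> f y = 0"
  obtains g where "functional g" "z \<leftharpoonup> g = y"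
proof -
  obtain p where p: "endo p" "\<And>x. p x \<in> orbit z" "\<And>x. x \<in> orbit z \<Longrightarrow> p x = x"
    using ex_projection[OF subspace_orbit] by blast
  have "\<exists>f. functional f \<and> f \<rightharpoonup> z = p x" for x
    using p(2)[of x] unfolding orbit_def by fastforce
  then obtain F where F: "\<And>x. functional (F x)" "\<And>x. F x \<rightharpoonup> z = p x"
    by metis
  have unique: "f y = F x y" if f: "functional f" "f \<rightharpoonup> z = p x" for f x
  proof -
    have fn: "functional (\<lambda>b. f b + (-1) * F x b)"
      by (intro functional_add functional_scale f(1) F(1))
    have "(\<lambda>b. f b + (-1) * F x b) \<rightharpoonup> z = 0"
      unfolding hit_left_add[symmetric] hit_left_scale[symmetric] f(2) F(2) by simp
    from z[OF fn this] show ?thesis by simp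
  qed
  have g: "functional (\<lambda>x. F x y)"
  proof (rule functionalI)
    fix a b c
    have "(\<lambda>v. F a v + F b v) \<rightharpoonup> z = p (a + b)"
      unfolding hit_left_add[symmetric] F(2) endoD(1)[OF p(1)] ..
    from unique[OF functional_add[OF F(1) F(1)] this] show "F (a + b) y = F a y + F b y" by simp
    have "(\<lambda>v. c * F a v) \<rightharpoonup> z = p (scale c a)"
      unfolding hit_left_scale[symmetric] F(2) endoD(2)[OF p(1)] ..
    from unique[OF functional_scale[OF F(1)] this] show "F (scale c a) y = c * F a y" by simp
  qed
  have "f (z \<leftharpoonup> (\<lambda>x. F x y)) = f y" if f: "functional f" for f
    using unique[OF f p(3)[OF orbitI[OF f], symmetric]] hit_adjoint[OF f g] by simp
  then have "z \<leftharpoonup> (\<lambda>x. F x y) = y"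
    by (rule eq_if_functionals_eq)
  with g show thesis by (rule that)
qed

lemma orbit_translates_sum:
  assumes "z \<in> span {y \<leftharpoonup> g | y g. y \<in> orbit x \<and> functional g}"
  shows "\<exists>(r::nat) ys gs. (\<forall>i<r. ys i \<in> orbit x \<and> functional (gs i)) \<and> z = (\<Sum>i<r. ys i \<leftharpoonup> gs i)"
  using assms
proof (induction rule: span_induct_alt)
  case base
  show ?case
    by (rule exI[of _ 0]) simp
next
  case (step c s z)
  then obtain r ys gs y g where IH: "\<forall>i<r::nat. ys i \<in> orbit x \<and> functional (gs i)"
      "z = (\<Sum>i<r. ys i \<leftharpoonup> gs i)" and s: "s = y \<leftharpoonup> g" "y \<in> orbit x" "functional g"
    by blast
  let ?ys = "ys(r := scale c y)" and ?gs = "gs(r := g)"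
  have "\<forall>i<Suc r. ?ys i \<in> orbit x \<and> functional (?gs i)"
    using IH(1) s subspace_scale[OF subspace_orbit s(2)] by (simp add: less_Suc_eq)
  moreover have "scale c s + z = (\<Sum>i<Suc r. ?ys i \<leftharpoonup> ?gs i)"
    by (simp add: IH(2) s(1) endoD(2)[OF endo_hit_right[OF s(3)]])
  ultimately show ?case by blast
qed

text \<open>
  Let \<open>N\<close> be the right coideal generated by \<open>x\<close>; the hypothesis says that it is simple.  The sum
  \<open>C\<close> of its translates \<open>N \<leftharpoonup> g\<close> is a subcoalgebra containing \<open>x\<close>, and the point is that \<open>C\<close> is simple.

  Given a nonzero subcoalgebra \<open>D \<subseteq> C\<close>, take a nonzero \<open>z = \<Sum> y\<^sub>i \<leftharpoonup> g\<^sub>i\<close> in \<open>D\<close> with the least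
  possible number of terms, and let \<open>y\<close> be the last \<open>y\<^sub>i\<close>.  If \<open>f \<rightharpoonup> z = 0\<close> then \<open>f \<rightharpoonup> y = 0\<close>: otherwise
  simplicity of \<open>N\<close> gives an operator \<open>E\<close>, composed of \<open>f \<rightharpoonup>\<close> and two further actions, with \<open>E y = y\<close>, and
  \<open>z = z - E z = \<Sum> (y\<^sub>i - E y\<^sub>i) \<leftharpoonup> g\<^sub>i\<close> is a shorter expression.  Hence \<open>y = z \<leftharpoonup> g\<close> for some \<open>g\<close>, so
  \<open>y \<in> D\<close>, and \<open>y\<close> generates \<open>N\<close>, whose translates make up \<open>C\<close>.
\<close>

lemma coradical_if_simple_orbit:
  assumes "x \<noteq> 0" and simple: "\<And>y. y \<in> orbit x \<Longrightarrow> y \<noteq> 0 \<Longrightarrow> x \<in> orbit y"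
  shows "x \<in> coradical scale comult"
proof -
  define G where "G = {y \<leftharpoonup> g | y g. y \<in> orbit x \<and> functional g}"
  define C where "C = span G"
  have GI: "y \<in> orbit x \<Longrightarrow> functional g \<Longrightarrow> y \<leftharpoonup> g \<in> C" for y g
    unfolding C_def G_def by (rule span_base) blast
  have C: "subspace C"
    by (simp add: C_def)
  have "f \<rightharpoonup> z \<in> C \<and> z \<leftharpoonup> f \<in> C" if z: "z \<in> C" and f: "functional f" for f z
    using z unfolding C_def
  proof (induction rule: span_induct_alt)
    case base
    show ?case
      using endoD(3)[OF endo_hit_left[OF f]] endoD(3)[OF endo_hit_right[OF f]] by (simp add: span_zero)
  next
    case (step c s z)
    from \<open>s \<in> G\<close> obtain y g where s: "s = y \<leftharpoonup> g" "y \<in> orbit x" "functional g"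
      by (auto simp: G_def)
    have "f \<rightharpoonup> s \<in> C"
      unfolding s(1) hit_commute[OF f s(3), symmetric]
      by (rule GI[OF hit_left_in_orbit[OF s(2) f] s(3)])
    moreover have "s \<leftharpoonup> f \<in> C"
      unfolding s(1) hit_right_hit_right[OF f s(3)]
      by (rule GI[OF s(2) functional_compose[OF f endo_hit_right[OF s(3)]]])
    ultimately show ?case
      using step.IH
      by (simp add: C_def endoD(1,2)[OF endo_hit_left[OF f]] endoD(1,2)[OF endo_hit_right[OF f]]
          span_add span_scale)
  qed
  with C have "stable C"
    by (simp add: stable_def)
  have x: "x \<in> C"
    using GI[OF self_in_orbit functional_counit] by simp
  have "D = C" if D: "subcoalgebra scale comult D" "D \<subseteq> C" "D \<noteq> {0}" for D
  proof -
    note D' = stable_if_subcoalgebra[OF D(1)]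
    let ?Q = "\<lambda>r z. z \<in> D \<and> z \<noteq> 0 \<and> (\<exists>ys gs. (\<forall>i<r::nat. ys i \<in> orbit x \<and> functional (gs i))
        \<and> z = (\<Sum>i<r. ys i \<leftharpoonup> gs i))"
    define r where "r = (LEAST r. \<exists>z. ?Q r z)"
    obtain z where "z \<in> D" "z \<noteq> 0"
      using D(3) subspace_0[OF stableD(1)[OF D']] by auto
    then have "\<exists>r z. ?Q r z"
      using orbit_translates_sum[of z x] D(2) unfolding C_def G_def by blast
    then have "\<exists>z. ?Q r z"
      unfolding r_def by (rule LeastI_ex)
    then obtain z ys gs where z: "z \<in> D" "z \<noteq> 0" "z = (\<Sum>i<r. ys i \<leftharpoonup> gs i)"
      and ys: "\<And>i. i < r \<Longrightarrow> ys i \<in> orbit x" and gs: "\<And>i. i < r \<Longrightarrow> functional (gs i)"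
      by blast
    have "r \<noteq> 0"
      using z(2) by (rule contrapos_nn) (simp add: z(3))
    then obtain n where n: "r = Suc n"
      using not0_implies_Suc by blast
    \<comment> \<open>By the minimality of \<open>r\<close> no nonzero element of \<open>D\<close> is a sum over \<open>i < n\<close>.\<close>
    have shorter: False
      if "z' \<in> D" "z' \<noteq> 0" "z' = (\<Sum>i<n. ys' i \<leftharpoonup> gs i)" "\<And>i. i < n \<Longrightarrow> ys' i \<in> orbit x" for z' ys'
    proof -
      have "?Q n z'"
        using that gs n by (intro conjI exI[of _ ys'] exI[of _ gs]) auto
      then have "r \<le> n"
        unfolding r_def by (intro Least_le) blast
      with n show False by simp
    qed
    define y where "y = ys n"
    have y: "y \<in> orbit x"
      unfolding y_def by (rule ys) (simp add: n)
    have y0: "y \<noteq> 0"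
    proof
      assume "y = 0"
      then have "z = (\<Sum>i<n. ys i \<leftharpoonup> gs i)"
        using z(3) endoD(3)[OF endo_hit_right[OF gs[of n]]] by (simp add: n y_def)
      from shorter[OF z(1,2) this] ys n show False by simp
    qed
    have key: "f y = 0" if f: "functional f" and fz: "f \<rightharpoonup> z = 0" for f
    proof -
      have "f \<rightharpoonup> y = 0"
      proof (rule ccontr)
        assume "f \<rightharpoonup> y \<noteq> 0"
        then obtain h where h: "functional h" "x = h \<rightharpoonup> (f \<rightharpoonup> y)"
          using simple[OF hit_left_in_orbit[OF y f]] by (auto elim: orbitE)
        from y obtain k where k: "functional k" "y = k \<rightharpoonup> x"
          by (rule orbitE)
        define E where "E v = k \<rightharpoonup> (h \<rightharpoonup> (f \<rightharpoonup> v))" for v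
        have E: "endo E"
          unfolding E_def by (intro endo_compose[OF endo_hit_left endo_compose[OF endo_hit_left]]
              endo_hit_left f h(1) k(1))
        \<comment> \<open>The two actions commute, so \<open>E\<close> can be applied to each term of \<open>z\<close>.\<close>
        have E_hit: "E (v \<leftharpoonup> g) = E v \<leftharpoonup> g" if g: "functional g" for v g
          unfolding E_def hit_commute[OF k(1) g] hit_commute[OF h(1) g] hit_commute[OF f g] ..
        have E_orbit: "E v \<in> orbit x" if "v \<in> orbit x" for v
          unfolding E_def by (intro hit_left_in_orbit that f h(1) k(1))
        have "E z = 0"
          unfolding E_def fz endoD(3)[OF endo_hit_left[OF h(1)]] endoD(3)[OF endo_hit_left[OF k(1)]] ..
        interpret E: Vector_Spaces.linear scale scale E by (rule E)
        have "z = z - E z"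
          using \<open>E z = 0\<close> by simp
        also have "\<dots> = (\<Sum>i<r. (ys i \<leftharpoonup> gs i) - (E (ys i) \<leftharpoonup> gs i))"
          using z(3) by (simp add: E.sum sum_subtractf gs E_hit)
        also have "\<dots> = (\<Sum>i<r. (ys i - E (ys i)) \<leftharpoonup> gs i)"
          by (intro sum.cong refl) (simp add: endoD(4)[OF endo_hit_right[OF gs]])
        also have "\<dots> = (\<Sum>i<n. (ys i - E (ys i)) \<leftharpoonup> gs i)"
        proof -
          have "E y = y"
            unfolding E_def h(2)[symmetric] k(2)[symmetric] ..
          then show ?thesis
            using endoD(3)[OF endo_hit_right[OF gs[of n]]] by (simp add: n y_def)
        qed
        finally show False
          by (rule shorter[OF z(1,2)]) (simp add: n ys E_orbit subspace_diff[OF subspace_orbit])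
      qed
      then show ?thesis
        using counit_hit_left[OF f, of y] functionalD(3)[OF functional_counit] by simp
    qed
    obtain g where "functional g" "z \<leftharpoonup> g = y"
      by (rule hit_right_eqI[OF key])
    then have "y \<in> D"
      using stableD(3)[OF D' z(1)] by blast
    then have "x \<in> D"
      using simple[OF y y0] orbit_subset_stable[OF D'] by blast
    then have "G \<subseteq> D"
      using stableD(3)[OF D'] orbit_subset_stable[OF D'] by (auto simp: G_def)
    then have "C \<subseteq> D"
      unfolding C_def by (rule span_minimal[OF _ stableD(1)[OF D']])
    with D(2) show ?thesis by blast
  qed
  then have "simple_subcoalgebra scale comult C"
    unfolding simple_subcoalgebra_def
    using subcoalgebra_if_stable[OF \<open>stable C\<close>] x \<open>x \<noteq> 0\<close> by auto
  then show ?thesis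
    unfolding coradical_def using x by (intro span_base) blast
qed


section \<open>Stable subspaces closed under the wedge\<close>

text \<open>The largest stable subspace of \<open>V\<close>, that is, the largest subcoalgebra inside \<open>V\<close>.\<close>

definition core :: "'h set \<Rightarrow> 'h set" where
  "core V = {x. \<forall>f g. functional f \<longrightarrow> functional g \<longrightarrow> (f \<rightharpoonup> x) \<leftharpoonup> g \<in> V}"

lemma core_subset: "core V \<subseteq> V"
proof
  fix x assume "x \<in> core V"
  then have "(counit \<rightharpoonup> x) \<leftharpoonup> counit \<in> V"
    using functional_counit unfolding core_def by blast
  then show "x \<in> V" by simp
qed

lemma stable_subset_core:
  assumes "stable C" "C \<subseteq> V"
  shows "C \<subseteq> core V"
  using stableD[OF assms(1)] assms(2) unfolding core_def by blast

lemma stable_core: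
  assumes V: "subspace V"
  shows "stable (core V)"
  unfolding stable_def
proof (intro conjI ballI allI impI)
  have *: "endo (\<lambda>x. (f \<rightharpoonup> x) \<leftharpoonup> g)" if "functional f" "functional g" for f g
    by (intro endo_compose[OF endo_hit_right endo_hit_left] that)
  show "subspace (core V)"
    by (rule subspaceI)
      (simp_all add: core_def endoD[OF *] subspace_0[OF V] subspace_add[OF V] subspace_scale[OF V])
  fix x h assume x: "x \<in> core V" and h: "functional h"
  show "h \<rightharpoonup> x \<in> core V"
    unfolding core_def
  proof (intro CollectI allI impI)
    fix f g assume f: "functional f" and g: "functional g"
    have "functional (\<lambda>b. f (h \<rightharpoonup> b))"
      by (rule functional_compose[OF f endo_hit_left[OF h]])
    then show "(f \<rightharpoonup> (h \<rightharpoonup> x)) \<leftharpoonup> g \<in> V"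
      unfolding hit_left_hit_left[OF f h] using x g unfolding core_def by blast
  qed
  show "x \<leftharpoonup> h \<in> core V"
    unfolding core_def
  proof (intro CollectI allI impI)
    fix f g assume f: "functional f" and g: "functional g"
    have "functional (\<lambda>b. g (b \<leftharpoonup> h))"
      by (rule functional_compose[OF g endo_hit_right[OF h]])
    then show "(f \<rightharpoonup> (x \<leftharpoonup> h)) \<leftharpoonup> g \<in> V"
      unfolding hit_commute[OF f h, symmetric] hit_right_hit_right[OF g h]
      using x f unfolding core_def by blast
  qed
qed

text \<open>
  For a subspace \<open>D\<close> this is \<open>D \<and> D\<close>, the preimage of \<open>D \<otimes> H + H \<otimes> D\<close> under the coproduct: modulo
  \<open>H \<otimes> D\<close>, a tensor lies in \<open>D \<otimes> H\<close> if and only if every functional that kills \<open>D\<close> annihilates it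
  when applied to the first factor.
\<close>

definition wedge :: "'h set \<Rightarrow> 'h set" where
  "wedge D = {x. \<forall>f. functional f \<longrightarrow> (\<forall>d\<in>D. f d = 0) \<longrightarrow> x \<leftharpoonup> f \<in> D}"

lemma wedgeI: "(\<And>f. functional f \<Longrightarrow> (\<And>d. d \<in> D \<Longrightarrow> f d = 0) \<Longrightarrow> x \<leftharpoonup> f \<in> D) \<Longrightarrow> x \<in> wedge D"
  by (simp add: wedge_def)

lemma wedgeD: "x \<in> wedge D \<Longrightarrow> functional f \<Longrightarrow> (\<And>d. d \<in> D \<Longrightarrow> f d = 0) \<Longrightarrow> x \<leftharpoonup> f \<in> D"
  by (simp add: wedge_def)

lemma stable_wedge:
  assumes "stable D"
  shows "stable (wedge D)"
  unfolding stable_def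
proof (intro conjI ballI allI impI)
  note D = stableD(1)[OF assms]
  show "subspace (wedge D)"
    by (rule subspaceI)
      (simp_all add: wedge_def endoD[OF endo_hit_right] subspace_0[OF D] subspace_add[OF D] subspace_scale[OF D])
  fix x h assume x: "x \<in> wedge D" and h: "functional h"
  show "h \<rightharpoonup> x \<in> wedge D"
  proof (rule wedgeI)
    fix f assume f: "functional f" "\<And>d. d \<in> D \<Longrightarrow> f d = 0"
    show "(h \<rightharpoonup> x) \<leftharpoonup> f \<in> D"
      unfolding hit_commute[OF h f(1)] by (rule stableD(2)[OF assms wedgeD[OF x f] h])
  qed
  show "x \<leftharpoonup> h \<in> wedge D"
  proof (rule wedgeI)
    fix f assume f: "functional f" "\<And>d. d \<in> D \<Longrightarrow> f d = 0"
    show "(x \<leftharpoonup> h) \<leftharpoonup> f \<in> D"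
      unfolding hit_right_hit_right[OF f(1) h]
      by (rule wedgeD[OF x functional_compose[OF f(1) endo_hit_right[OF h]]])
        (rule f(2)[OF stableD(3)[OF assms _ h]])
  qed
qed

lemma stable_coradical: "stable (coradical scale comult)"
  unfolding stable_def
proof (intro conjI ballI allI impI)
  show "subspace (coradical scale comult)"
    by (simp add: coradical_def)
  have "f \<rightharpoonup> x \<in> coradical scale comult \<and> x \<leftharpoonup> f \<in> coradical scale comult"
    if "x \<in> coradical scale comult" and f: "functional f" for x f
    using that(1) unfolding coradical_def
  proof (induction rule: span_induct_alt)
    case base
    show ?case
      using endoD(3)[OF endo_hit_left[OF f]] endoD(3)[OF endo_hit_right[OF f]] by (simp add: span_zero)
  next
    case (step c s z)
    then obtain C where C: "simple_subcoalgebra scale comult C" "s \<in> C"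
      by blast
    then have "stable C"
      by (simp add: simple_subcoalgebra_def stable_if_subcoalgebra)
    from stableD(2,3)[OF this C(2) f]
    have "f \<rightharpoonup> s \<in> span (\<Union>{C. simple_subcoalgebra scale comult C})"
        "s \<leftharpoonup> f \<in> span (\<Union>{C. simple_subcoalgebra scale comult C})"
      using C(1) by (blast intro: span_base)+
    then show ?case
      using step.IH
      by (simp add: endoD(1,2)[OF endo_hit_left[OF f]] endoD(1,2)[OF endo_hit_right[OF f]]
          span_add span_scale)
  qed
  then show "f \<rightharpoonup> x \<in> coradical scale comult" "x \<leftharpoonup> f \<in> coradical scale comult"
    if "x \<in> coradical scale comult" "functional f" for x f
    using that by blast+
qed

text \<open>
  This replaces the exhaustiveness of the coradical filtration.  Among the elements outside \<open>D\<close>, one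
  that generates a right coideal of least dimension is recovered from each \<open>y \<notin> D\<close> in that right coideal,
  since otherwise \<open>y\<close> would generate a smaller one.  Thus a map \<open>y \<mapsto> y \<leftharpoonup> f\<close> with \<open>f\<close> zero on \<open>D\<close>
  turns the right coideal into zero or a simple one.
\<close>

lemma wedge_closed_eq_UNIV:
  assumes D: "stable D" and coradical: "coradical scale comult \<subseteq> D" and wedge: "wedge D \<subseteq> D"
  shows "D = UNIV"
proof (rule ccontr)
  assume "D \<noteq> UNIV"
  then obtain x0 where x0: "x0 \<notin> D" by blast
  let ?Q = "\<lambda>m x. x \<notin> D \<and> (\<exists>T. finite T \<and> card T = m \<and> orbit x \<subseteq> span T)"
  define m where "m = (LEAST m. \<exists>x. ?Q m x)"
  let ?T = "fst ` Poly_Mapping.keys (cop x0)"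
  have "?Q (card ?T) x0"
    using x0 orbit_finitely_spanned[of x0] by (intro conjI exI[of _ ?T]) simp_all
  then have "\<exists>m x. ?Q m x"
    by (intro exI)
  then have "\<exists>x. ?Q m x"
    unfolding m_def by (rule LeastI_ex)
  then obtain x T where x: "x \<notin> D" and T: "finite T" "card T = m" "orbit x \<subseteq> span T"
    by blast
  \<comment> \<open>If \<open>y\<close> does not give back \<open>x\<close>, then a basis \<open>B\<close> of its right coideal can be enlarged by \<open>x\<close>
     inside \<open>span T\<close>, hence has fewer than \<open>m\<close> elements.\<close>
  have generates: "x \<in> orbit y" if y: "y \<in> orbit x" "y \<notin> D" for y
  proof (rule ccontr)
    assume "x \<notin> orbit y"
    obtain B where B: "B \<subseteq> orbit y" "independent B" "orbit y \<subseteq> span B"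
      by (rule maximal_independent_subset)
    have "span B \<subseteq> orbit y"
      by (rule span_minimal[OF B(1) subspace_orbit])
    with \<open>x \<notin> orbit y\<close> have nx: "x \<notin> span B" by blast
    have "insert x B \<subseteq> span T"
      using subsetD[OF T(3) self_in_orbit] order_trans[OF B(1) order_trans[OF orbit_subset[OF y(1)] T(3)]]
      by (simp only: insert_subset)
    from independent_span_bound[OF T(1) independent_insertI[OF nx B(2)] this]
    have "finite B" "card (insert x B) \<le> m"
      using T(2) by auto
    moreover have "x \<notin> B"
      using nx span_base by blast
    ultimately have "card B < m" by simp
    moreover have "m \<le> card B"
      unfolding m_def
      by (rule Least_le) (intro exI[of _ y] exI[of _ B] conjI y(2) \<open>finite B\<close> refl B(3))
    ultimately show False by simp
  qed
  have "x \<in> wedge D"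
  proof (rule wedgeI)
    fix f assume f: "functional f" "\<And>d. d \<in> D \<Longrightarrow> f d = 0"
    have f0: "d \<leftharpoonup> f = 0" if "d \<in> D" for d
    proof (rule eq_if_functionals_eq)
      fix h assume h: "functional h"
      have "h (d \<leftharpoonup> f) = f (h \<rightharpoonup> d)"
        by (rule hit_adjoint[OF h f(1)])
      also have "\<dots> = h 0"
        unfolding functionalD(3)[OF h] by (rule f(2)[OF stableD(2)[OF D that h]])
      finally show "h (d \<leftharpoonup> f) = h 0" .
    qed
    show "x \<leftharpoonup> f \<in> D"
    proof (cases "x \<leftharpoonup> f = 0")
      case True
      then show ?thesis using subspace_0[OF stableD(1)[OF D]] by simp
    next
      case False
      have "x \<leftharpoonup> f \<in> coradical scale comult"
      proof (rule coradical_if_simple_orbit[OF False])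
        fix y assume "y \<in> orbit (x \<leftharpoonup> f)" "y \<noteq> 0"
        then obtain h where h: "functional h" "y = h \<rightharpoonup> (x \<leftharpoonup> f)"
          by (elim orbitE)
        then have y: "y = (h \<rightharpoonup> x) \<leftharpoonup> f"
          using hit_commute[OF h(1) f(1)] by simp
        with \<open>y \<noteq> 0\<close> f0 have "h \<rightharpoonup> x \<notin> D" by blast
        from generates[OF orbitI[OF h(1)] this] obtain k where k: "functional k" "x = k \<rightharpoonup> (h \<rightharpoonup> x)"
          by (rule orbitE)
        have "x \<leftharpoonup> f = k \<rightharpoonup> y"
          unfolding y hit_commute[OF k(1) f(1), symmetric] k(2)[symmetric] ..
        then show "x \<leftharpoonup> f \<in> orbit y"
          using orbitI[OF k(1), of y] by simp
      qed
      with coradical show ?thesis by blast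
    qed
  qed
  with wedge x show False by blast
qed

end

section \<open>The antipode\<close>

context hopf_algebra
begin

lemma endo_mult_left: "endo (\<lambda>x. a * x)"
  by (rule endoI) (simp_all add: distrib_left scale_mult_right)

lemma endo_mult_right: "endo (\<lambda>x. x * a)"
  by (rule endoI) (simp_all add: distrib_right scale_mult_left)

lemma endo_mult: "endo q \<Longrightarrow> endo (\<lambda>x. a * q x)" "endo q \<Longrightarrow> endo (\<lambda>x. q x * a)"
  using endo_compose[OF endo_mult_left] endo_compose[OF endo_mult_right] by blast+

lemma bilinear_mult: "endo q \<Longrightarrow> endo r \<Longrightarrow> bilinear (\<lambda>a b. q a * r b)"
  by (rule bilinearI) (rule endo_mult; assumption)+

lemma sweedler_antipode:
  "sweedler (\<lambda>a b. antipode a * b) x = scale (counit x) 1"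
  "sweedler (\<lambda>a b. a * antipode b) x = scale (counit x) 1"
  by (simp_all add: sweedler_def antipode_left[OF cop_in_comult] antipode_right[OF cop_in_comult])

lemma sweedler_counit_scale:
  assumes "endo q"
  shows "sweedler (\<lambda>a b. q a * scale (counit b) 1) x = q x"
    "sweedler (\<lambda>a b. scale (counit a) 1 * q b) x = q x"
proof -
  have "q (sweedler (\<lambda>a b. scale (counit b) a) x) = q x" "q (sweedler (\<lambda>a b. scale (counit a) b) x) = q x"
    by (simp_all only: sweedler_counit)
  then show "sweedler (\<lambda>a b. q a * scale (counit b) 1) x = q x"
      "sweedler (\<lambda>a b. scale (counit a) 1 * q b) x = q x"
    by (simp_all add: endo_apply_sweedler[OF assms] endoD(2)[OF assms] scale_mult_left scale_mult_right)
qed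

text \<open>
  Convolve the hypothesis \<open>q * id = c \<epsilon>\<close> on the right with \<open>S\<close>, the convolution inverse of the identity.
\<close>

lemma eq_mult_antipode:
  assumes q: "endo q" and eq: "\<And>x. sweedler (\<lambda>a b. q a * b) x = scale (counit x) c"
  shows "q x = c * antipode x"
proof -
  have "q x = sweedler (\<lambda>a b. q a * sweedler (\<lambda>b c. b * antipode c) b) x"
    by (simp only: sweedler_antipode sweedler_counit_scale[OF q])
  also have "\<dots> = sweedler (\<lambda>a b. sweedler (\<lambda>b c. q a * b * antipode c) b) x"
    by (simp only: endo_apply_sweedler[OF endo_mult_left] mult.assoc)
  also have "\<dots> = sweedler (\<lambda>a c. sweedler (\<lambda>a b. q a * b * antipode c) a) x"
    by (rule sweedler_coassoc[symmetric])
      (intro endo_mult endo_id antipode_linear q)+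
  also have "\<dots> = sweedler (\<lambda>a b. scale (counit a) 1 * (c * antipode b)) x"
    by (simp only: endo_apply_sweedler[OF endo_mult_right, symmetric] eq)
      (simp only: scale_mult_left mult_1_left)
  also have "\<dots> = c * antipode x"
    by (rule sweedler_counit_scale(2)) (intro endo_mult antipode_linear)
  finally show ?thesis .
qed

lemma sweedler_antipode_mult:
  "sweedler (\<lambda>a b. sweedler (\<lambda>c d. antipode (a * c) * (b * d)) y) x = scale (counit x * counit y) 1"
proof -
  have "scale (counit x * counit y) 1
      = free_extend scale (\<lambda>(a, b). antipode a * b) (tensor_mult (cop x) (cop y))"
    using antipode_left[OF comult_mult[OF cop_in_comult cop_in_comult]] by (simp add: counit_mult)
  also have "\<dots> = sweedler (\<lambda>a b. sweedler (\<lambda>c d. antipode (a * c) * (b * d)) y) x"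
    unfolding tensor_mult_def linear_free_extend[OF free_extend_linear]
    unfolding case_prod_unfold linear_free_extend[OF free_extend_linear] sweedler_def by simp
  finally show ?thesis ..
qed

text \<open>
  Applying \<open>eq_mult_antipode\<close> in one variable at a time avoids a convolution product on \<open>H \<otimes> H\<close>.
  The equation \<open>\<Sum> S(x\<^sub>1 y\<^sub>1) x\<^sub>2 y\<^sub>2 = \<epsilon>(x) \<epsilon>(y)\<close>, seen as one in \<open>y\<close>, gives
  \<open>\<Sum> S(x\<^sub>1 y) x\<^sub>2 = \<epsilon>(x) S(y)\<close>; seen as one in \<open>x\<close>, this in turn gives \<open>S(x y) = S(y) S(x)\<close>.
\<close>

lemma antipode_mult: "antipode (x * y) = antipode y * antipode x"
proof -
  have 1: "sweedler (\<lambda>a b. antipode (a * y) * b) x = scale (counit x) 1 * antipode y" for x y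
  proof (rule eq_mult_antipode)
    show "endo (\<lambda>y. sweedler (\<lambda>a b. antipode (a * y) * b) x)"
      by (intro endo_sweedler_param endo_mult(2) endo_compose[OF antipode_linear endo_mult_left])
    fix y
    have "sweedler (\<lambda>c d. sweedler (\<lambda>a b. antipode (a * c) * b) x * d) y
        = sweedler (\<lambda>c d. sweedler (\<lambda>a b. antipode (a * c) * (b * d)) x) y"
      by (simp only: endo_apply_sweedler[OF endo_mult_right] mult.assoc)
    also have "\<dots> = scale (counit y) (scale (counit x) 1)"
      by (subst sweedler_swap) (simp add: sweedler_antipode_mult mult.commute)
    finally show "sweedler (\<lambda>c d. sweedler (\<lambda>a b. antipode (a * c) * b) x * d) y
        = scale (counit y) (scale (counit x) 1)" .
  qed
  show ?thesis
  proof (rule eq_mult_antipode)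
    show "endo (\<lambda>x. antipode (x * y))"
      by (rule endo_compose[OF antipode_linear endo_mult_right])
    show "sweedler (\<lambda>a b. antipode (a * y) * b) x = scale (counit x) (antipode y)" for x
      by (simp add: 1 scale_mult_left)
  qed
qed

lemma antipode_one: "antipode 1 = 1"
  using antipode_left[OF comult_one] by (simp add: counit_one)

text \<open>
  The expansion of \<open>0 = \<Sum> q(x\<^sub>1) S(x\<^sub>2) q(x\<^sub>3)\<close> is organised through \<open>\<psi>(b) = \<Sum> S(b\<^sub>1) q(b\<^sub>2)\<close>, which
  equals \<open>\<epsilon>(b)\<close> up to an element \<open>\<rho>(b)\<close> of \<open>K\<close>.  Like \<open>q\<close>, the map \<open>\<psi>\<close> vanishes on the largest
  subcoalgebra of \<open>K\<close>, and this makes the sum zero for \<open>x\<close> in the wedge.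
\<close>

lemma wedge_core_subset:
  assumes K: "subspace K" "\<And>a b. a \<in> K \<Longrightarrow> b \<in> K \<Longrightarrow> a * b \<in> K" "1 \<in> K" "range antipode \<subseteq> K"
  shows "wedge (core K) \<subseteq> K"
proof
  fix x assume x: "x \<in> wedge (core K)"
  obtain p where p: "endo p" "\<And>x. p x \<in> K" "\<And>x. x \<in> K \<Longrightarrow> p x = x"
    using ex_projection[OF K(1)] by blast
  define q where "q a = a - p a" for a
  have q: "endo q"
    unfolding q_def by (rule endo_diff[OF endo_id p(1)])
  have core: "f \<rightharpoonup> d \<in> core K" "d \<leftharpoonup> f \<in> core K" if "d \<in> core K" "functional f" for f d
    using stableD(2,3)[OF stable_core[OF K(1)] that] .
  have q0: "q d = 0" if "d \<in> core K" for d
    using p(3) core_subset[of K] that by (auto simp: q_def)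
  define \<psi> where "\<psi> b = sweedler (\<lambda>c d. antipode c * q d) b" for b
  define \<rho> where "\<rho> b = sweedler (\<lambda>c d. antipode c * p d) b" for b
  have \<psi>: "endo \<psi>" and \<rho>: "endo \<rho>"
    unfolding \<psi>_def \<rho>_def by (intro endo_sweedler bilinear_mult antipode_linear q p(1))+
  have \<psi>0: "\<psi> d = 0" if d: "d \<in> core K" for d
    unfolding \<psi>_def
  proof (rule sweedler_eq_0[OF bilinear_mult[OF endo_id endo_id] antipode_linear q])
    fix f assume "functional f"
    then show "q (d \<leftharpoonup> (\<lambda>a. f (antipode a))) = 0"
      by (intro q0 core(2)[OF d] functional_compose[OF _ antipode_linear])
  qed
  have \<rho>K: "\<rho> b \<in> K" for b
    unfolding \<rho>_def by (rule sweedler_mem[OF K(1)]) (intro K(2) p(2) subsetD[OF K(4)] rangeI)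
  have \<psi>_eq: "\<psi> b = scale (counit b) 1 - \<rho> b" for b
    unfolding \<psi>_def \<rho>_def q_def right_diff_distrib sweedler_diff sweedler_antipode ..
  have "0 = sweedler (\<lambda>a b. q a * \<psi> b) x"
  proof (rule sweedler_eq_0[OF bilinear_mult[OF endo_id endo_id] q \<psi>, symmetric], rule \<psi>0, rule wedgeD[OF x])
    fix f assume f: "functional f"
    show "functional (\<lambda>a. f (q a))"
      by (rule functional_compose[OF f q])
    show "f (q d) = 0" if "d \<in> core K" for d
      unfolding q0[OF that] by (rule functionalD(3)[OF f])
  qed
  also have "\<dots> = q x - sweedler (\<lambda>a b. q a * \<rho> b) x"
    unfolding \<psi>_eq right_diff_distrib sweedler_diff sweedler_counit_scale(1)[OF q] ..
  also have "sweedler (\<lambda>a b. q a * \<rho> b) x = sweedler (\<lambda>a b. a * \<rho> b) x - sweedler (\<lambda>a b. p a * \<rho> b) x"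
    unfolding q_def left_diff_distrib sweedler_diff ..
  also have "sweedler (\<lambda>a b. a * \<rho> b) x = sweedler (\<lambda>a b. sweedler (\<lambda>b c. a * antipode b * p c) b) x"
    unfolding \<rho>_def endo_apply_sweedler[OF endo_mult_left] mult.assoc ..
  also have "\<dots> = sweedler (\<lambda>a c. sweedler (\<lambda>a b. a * antipode b * p c) a) x"
    by (rule sweedler_coassoc[symmetric]) (intro endo_mult endo_id antipode_linear p(1))+
  also have "\<dots> = sweedler (\<lambda>a c. scale (counit a) 1 * p c) x"
    unfolding endo_apply_sweedler[OF endo_mult_right, symmetric] sweedler_antipode ..
  also have "\<dots> = p x"
    by (rule sweedler_counit_scale(2)[OF p(1)])
  finally have "x = p x + p x - sweedler (\<lambda>a b. p a * \<rho> b) x"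
    by (simp add: q_def algebra_simps)
  moreover have "sweedler (\<lambda>a b. p a * \<rho> b) x \<in> K"
    by (rule sweedler_mem[OF K(1)]) (intro K(2) p(2) \<rho>K)
  ultimately show "x \<in> K"
    using subspace_diff[OF K(1) subspace_add[OF K(1) p(2) p(2)]] by metis
qed

theorem subalgebra_eq_UNIV:
  assumes K: "subspace K" "\<And>a b. a \<in> K \<Longrightarrow> b \<in> K \<Longrightarrow> a * b \<in> K" "1 \<in> K" "range antipode \<subseteq> K"
    and coradical: "coradical scale comult \<subseteq> K"
  shows "K = UNIV"
proof -
  have stable: "stable (core K)"
    by (rule stable_core[OF K(1)])
  have "core K = UNIV"
  proof (rule wedge_closed_eq_UNIV[OF stable])
    show "coradical scale comult \<subseteq> core K"
      by (rule stable_subset_core[OF stable_coradical coradical])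
    show "wedge (core K) \<subseteq> core K"
      by (rule stable_subset_core[OF stable_wedge[OF stable] wedge_core_subset[OF K]])
  qed
  then show ?thesis
    using core_subset by blast
qed

end

theorem proposition2p7:
  fixes scale :: "'k::field \<Rightarrow> 'h::ring_1 \<Rightarrow> 'h"
    and comult :: "'h \<Rightarrow> ('h \<times> 'h \<Rightarrow>\<^sub>0 'k) set"
    and counit :: "'h \<Rightarrow> 'k"
    and S :: "'h \<Rightarrow> 'h"
  assumes "hopf_algebra scale comult counit S"
    and "coradical scale comult \<subseteq> range S"
  shows "surj S"
proof -
  interpret hopf_algebra scale comult counit S by (rule assms(1))
  show ?thesis
  proof (rule subalgebra_eq_UNIV)
    show "subspace (range S)"
    proof (rule subspaceI)
      show "0 \<in> range S"
        using endoD(3)[OF antipode_linear] by (rule range_eqI[OF sym])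
      show "v + w \<in> range S" if "v \<in> range S" "w \<in> range S" for v w
        using that by (elim rangeE) (simp only: endoD(1)[OF antipode_linear, symmetric] rangeI)
      show "scale c v \<in> range S" if "v \<in> range S" for c v
        using that by (elim rangeE) (simp only: endoD(2)[OF antipode_linear, symmetric] rangeI)
    qed
    show "a * b \<in> range S" if "a \<in> range S" "b \<in> range S" for a b
      using that by (elim rangeE) (simp only: antipode_mult[symmetric] rangeI)
    show "1 \<in> range S"
      using antipode_one by (rule range_eqI[OF sym])
  qed (use assms(2) in simp_all)
qed

end
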